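(* Let $a_k=2^{-2k}\binom{2k}{k}$ for $k\in\mathbb{N}$, so that $G_{1/2}(x)=\sum_{k\ge0}a_kx^k=\frac{1}{\sqrt{1-x}}$. For all $t\in\mathbb{N}$, $$\mathsf{space}_{G_{1/2}}(t;2t)=t+1.$$
   Context: Indices start at $0$, $\mathbb{N}=\{0,1,2,\dots\}$. For a sequence $a$ (equivalently its generating function $G=\sum a_kx^k$), $T[a]$ is the lower-triangular Toeplitz matrix with $T_{i,j}=a_{i-j}$ for $i\ge j$ and $0$ otherwise. Streaming model: a streaming algorithm consists of a buffer size function $\beta:\{-1\}\cup\mathbb{N}\to\mathbb{N}$ with $\beta(-1)=1$ and maps $u^{(t)}:\mathbb{R}^{\beta(t-1)}\times\mathbb{R}\to\mathbb{R}^{\beta(t)}$, $m^{(t)}:\mathbb{R}^{\beta(t)}\to\mathbb{R}$. On input $z\in\mathbb{R}^{\mathbb{N}}$, $s^{(-1)}=0\in\mathbb{R}$, $s^{(t)}=u^{(t)}(s^{(t-1)},z_t)$, output at time $t$ is $m^{(t)}(s^{(t)})$. For each $t$ the map $(z_0,\dots,z_t)\mapsto s^{(t)}$ must be continuous (output maps need not be). The algorithm computes $M$ correctly up to time $\tau$ if $m^{(t)}(s^{(t)})=(Mz)_t$ for all $z$ and all $t\le\tau$. $\mathsf{space}_M(t;\tau)$ is the minimum $b$ such that some streaming algorithm computes $M$ correctly up to time $\tau$ with $\max_{t'\le t}\beta(t')\le b$. $\mathsf{space}_{G}(t;\tau)$ denotes $\mathsf{space}_{T[a]}(t;\tau)$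 where $a$ is the coefficient sequence of $G$. *)

theory Defs
  imports "HOL-Analysis.Analysis"
begin

text \<open>
  \<^term>\<open>Euclidean_space n\<close> represents \<open>\<real>\<^sup>n\<close> by the functions \<^typ>\<open>nat \<Rightarrow> real\<close> vanishing at all
  indices \<open>\<ge> n\<close>. Buffer sizes are indexed by \<^typ>\<open>int\<close> because the initial state lives at time
  \<open>-1\<close>; only the values at times \<open>\<ge> -1\<close> matter.
\<close>

primrec stream_state ::
  "(nat \<Rightarrow> (nat \<Rightarrow> real) \<Rightarrow> real \<Rightarrow> (nat \<Rightarrow> real)) \<Rightarrow> (nat \<Rightarrow> real) \<Rightarrow> nat \<Rightarrow> (nat \<Rightarrow> real)"
where
  "stream_state u z 0 = u 0 (\<lambda>_. 0) (z 0)"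
| "stream_state u z (Suc t) = u (Suc t) (stream_state u z t) (z (Suc t))"

text \<open>
  The state at time \<open>t\<close> depends only on \<open>z\<^sub>0, \<dots>, z\<^sub>t\<close>, so the last condition is continuity of
  \<open>(z\<^sub>0, \<dots>, z\<^sub>t) \<mapsto> s\<^sup>(\<^sup>t\<^sup>)\<close> on \<open>\<real>\<^sup>t\<^sup>+\<^sup>1\<close>. Output maps \<open>m t\<close> are unrestricted.
\<close>

definition streaming_algorithm ::
  "(int \<Rightarrow> nat) \<Rightarrow> (nat \<Rightarrow> (nat \<Rightarrow> real) \<Rightarrow> real \<Rightarrow> (nat \<Rightarrow> real)) \<Rightarrow> (nat \<Rightarrow> (nat \<Rightarrow> real) \<Rightarrow> real) \<Rightarrow> bool"
where
  "streaming_algorithm \<beta> u m \<longleftrightarrow>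
     \<beta> (-1) = 1 \<and>
     (\<forall>t. \<forall>s \<in> topspace (Euclidean_space (\<beta> (int t - 1))). \<forall>x.
        u t s x \<in> topspace (Euclidean_space (\<beta> (int t)))) \<and>
     (\<forall>t. continuous_map (Euclidean_space (Suc t)) (Euclidean_space (\<beta> (int t)))
        (\<lambda>z. stream_state u z t))"

definition mat_apply :: "(nat \<Rightarrow> nat \<Rightarrow> real) \<Rightarrow> (nat \<Rightarrow> real) \<Rightarrow> nat \<Rightarrow> real" where
  "mat_apply M z i = (\<Sum>j. M i j * z j)"

definition computes_up_to ::
  "(nat \<Rightarrow> (nat \<Rightarrow> real) \<Rightarrow> real \<Rightarrow> (nat \<Rightarrow> real)) \<Rightarrow> (nat \<Rightarrow> (nat \<Rightarrow> real) \<Rightarrow> real) \<Rightarrow>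
   (nat \<Rightarrow> nat \<Rightarrow> real) \<Rightarrow> nat \<Rightarrow> bool"
where
  "computes_up_to u m M \<tau> \<longleftrightarrow>
     (\<forall>z. \<forall>t\<le>\<tau>. m t (stream_state u z t) = mat_apply M z t)"

text \<open>The infimum in \<^typ>\<open>enat\<close> is the minimum, or \<open>\<infinity>\<close> if no algorithm exists.\<close>

definition space_mat :: "(nat \<Rightarrow> nat \<Rightarrow> real) \<Rightarrow> nat \<Rightarrow> nat \<Rightarrow> enat" where
  "space_mat M t \<tau> = Inf {enat b | b. \<exists>\<beta> u m.
     streaming_algorithm \<beta> u m \<and> computes_up_to u m M \<tau> \<and> Max (\<beta> ` {-1..int t}) \<le> b}"

definition toeplitz :: "(nat \<Rightarrow> real) \<Rightarrow> nat \<Rightarrow> nat \<Rightarrow> real" where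
  "toeplitz a i j = (if j \<le> i then a (i - j) else 0)"

definition space_gf :: "real fps \<Rightarrow> nat \<Rightarrow> nat \<Rightarrow> enat" where
  "space_gf G = space_mat (toeplitz (fps_nth G))"

definition G_half :: "real fps" where
  "G_half = Abs_fps (\<lambda>k. real (2 * k choose k) / 2 ^ (2 * k))"

lemma G_half_nth_gchoose: "fps_nth G_half k = (-1) ^ k * ((-1/2) gchoose k)"
proof (induction k)
  case 0
  show ?case by (simp add: G_half_def)
next
  case (Suc k)
  define B C D where "B = (2 * Suc k choose Suc k)" and "C = (Suc (2 * k) choose k)"
    and "D = (2 * k choose k)"
  have "Suc k * B = 2 * Suc k * C"
    using Suc_times_binomial_eq[of "Suc (2 * k)" k] unfolding B_def C_def
    by (simp add: mult.commute del: binomial_Suc_Suc)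
  then have "real (Suc k) * real B = real (Suc k) * (2 * real C)"
    by (metis (no_types) mult.assoc mult.left_commute of_nat_mult of_nat_numeral)
  then have B: "real B = 2 * real C"
    by (simp del: of_nat_Suc)
  have "Suc k * C = Suc (2 * k) * D"
    using Suc_times_binomial_eq[of "2 * k" k] binomial_symmetric[of k "Suc (2 * k)"]
    unfolding C_def D_def by (simp add: mult.commute Suc_diff_le del: binomial_Suc_Suc)
  then have "real (Suc k) * real C = real (Suc (2 * k)) * real D"
    by (metis (no_types) of_nat_mult)
  then have "real (Suc k) * (real B / 2 ^ (2 * Suc k)) = (real k + 1/2) * (real D / 2 ^ (2 * k))"
    unfolding B by (simp add: field_simps)
  then have "real (Suc k) * fps_nth G_half (Suc k) = (real k + 1/2) * fps_nth G_half k"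
    by (simp only: G_half_def fps_nth_Abs_fps B_def D_def)
  also have "\<dots> = real (Suc k) * ((-1) ^ Suc k * ((-1/2) gchoose Suc k))"
  proof -
    have "real (Suc k) * ((-1/2) gchoose Suc k) = (-1/2 - real k) * ((-1/2) gchoose k)"
      by (metis gbinomial_absorb_comp gbinomial_absorption)
    then have "(-1) ^ Suc k * (real (Suc k) * ((-1/2) gchoose Suc k)) =
        (real k + 1/2) * ((-1) ^ k * ((-1/2) gchoose k))"
      by (simp only: power_Suc) (simp add: left_diff_distrib distrib_right right_diff_distrib)
    then show ?thesis
      by (metis (no_types) Suc.IH mult.left_commute)
  qed
  finally show ?case
    by (metis (no_types) mult_cancel_left of_nat_eq_0_iff nat.distinct(2))
qed

lemma G_half_sums:
  assumes "\<bar>x\<bar> < 1"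
  shows "(\<lambda>k. fps_nth G_half k * x ^ k) sums (1 / sqrt (1 - x))"
proof -
  have "(1 - x) powr (-1/2) = 1 / sqrt (1 - x)"
    using assms powr_minus_divide[of "1 - x" "1/2"] by (simp add: powr_half_sqrt)
  moreover have "((-1/2) gchoose k) * (- x) ^ k = fps_nth G_half k * x ^ k" for k
    by (simp add: G_half_nth_gchoose power_minus[of x])
  ultimately show ?thesis
    using gen_binomial_real[of "- x" "-1/2"] assms by simp
qed

end

theory Submission
  imports Defs "HOL-Homology.Invariance_of_Domain"
begin

text \<open>
  A lower triangular matrix can be applied by storing the whole input prefix, which takes \<open>t + 1\<close>
  cells at time \<open>t\<close>. Conversely, with fewer cells the state at time \<open>t\<close> is a continuous map from
  \<open>\<real>\<^sup>t\<^sup>+\<^sup>1\<close> to a space of smaller dimension, so by invariance of domain two distinct prefixes share a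
  state. Continued with zeros, both produce the same outputs at times \<open>t, \<dots>, 2t\<close>, so their
  difference, read backwards, is in the kernel of the Hankel matrix \<open>(a\<^sub>i\<^sub>+\<^sub>j)\<^sub>i\<^sub>,\<^sub>j\<^sub>\<le>\<^sub>t\<close>. But the \<open>a\<^sub>k\<close> are
  the moments of the arcsine distribution on \<open>[0, 1]\<close>, whose support is infinite, so this matrix is
  positive definite.
\<close>

section \<open>Continuous maps into lower-dimensional Euclidean spaces\<close>

lemma openin_Euclidean_space_coordinate_neq:
  assumes U: "openin (Euclidean_space m) U" and x: "x \<in> U" and "i < m"
  obtains y where "y \<in> U" "y i \<noteq> c"
proof (rule ccontr)
  assume "\<not> thesis"
  with that have const: "\<forall>y\<in>U. y i = c"
    by blast
  define h where "h s = (\<lambda>j. if j < m then (x(i := s)) j else 0)" for s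
  have "continuous_map euclideanreal (Euclidean_space m) h"
    unfolding h_def continuous_map_componentwise_Euclidean_space by (auto simp: fun_upd_def)
  then have "open {s. h s \<in> U}"
    using openin_continuous_map_preimage[OF _ U] by fastforce
  moreover have "{s. h s \<in> U} = {c}"
  proof -
    have "s = c" if "h s \<in> U" for s
      using const that \<open>i < m\<close> by (auto simp: h_def dest!: bspec)
    moreover have "h (x i) = x"
      using x openin_subset[OF U] by (auto simp: h_def topspace_Euclidean_space fun_eq_iff subset_iff)
    then have "h c \<in> U"
      using x const by metis
    ultimately show ?thesis
      by blast
  qed
  ultimately show False
    using not_open_singleton[of c] by simp
qed

lemma no_continuous_injection_Euclidean_space:
  assumes "n < m" and f: "continuous_map (Euclidean_space m) (Euclidean_space n) f"
  shows "\<not> inj_on f (topspace (Euclidean_space m))"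
proof
  let ?E = "topspace (Euclidean_space m)"
  assume inj: "inj_on f ?E"
  have image: "f x i = 0" if "x \<in> ?E" "n \<le> i" for x i
    using continuous_map_image_subset_topspace[OF f] that
    by (auto simp: topspace_Euclidean_space image_subset_iff)
  have "continuous_map (Euclidean_space m) (Euclidean_space m) f"
    using f image \<open>n < m\<close>
    by (auto simp: Euclidean_space_def continuous_map_in_subtopology)
  then have "openin (Euclidean_space m) (f ` ?E)"
    by (intro invariance_of_domain_Euclidean_space inj) (auto simp: subtopology_topspace)
  moreover have "f (\<lambda>_. 0) \<in> f ` ?E"
    by (simp add: topspace_Euclidean_space)
  ultimately obtain y where "y \<in> f ` ?E" "y n \<noteq> 0"
    using \<open>n < m\<close> by (rule openin_Euclidean_space_coordinate_neq)
  with image show False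
    by auto
qed

section \<open>Matrices with trivial kernel\<close>

definition trivial_kernel_on :: "nat set \<Rightarrow> nat set \<Rightarrow> (nat \<Rightarrow> nat \<Rightarrow> real) \<Rightarrow> bool" where
  "trivial_kernel_on I J M \<longleftrightarrow>
     (\<forall>w. (\<forall>i\<in>I. (\<Sum>j\<in>J. M i j * w j) = 0) \<longrightarrow> (\<forall>j\<in>J. w j = 0))"

definition positive_definite_on :: "nat set \<Rightarrow> (nat \<Rightarrow> nat \<Rightarrow> real) \<Rightarrow> bool" where
  "positive_definite_on I M \<longleftrightarrow>
     (\<forall>w. (\<exists>i\<in>I. w i \<noteq> 0) \<longrightarrow> 0 < (\<Sum>i\<in>I. \<Sum>j\<in>I. w i * M i j * w j))"

definition hankel :: "(nat \<Rightarrow> real) \<Rightarrow> nat \<Rightarrow> nat \<Rightarrow> real" where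
  "hankel a i j = a (i + j)"

lemma positive_definite_on_imp_trivial_kernel_on:
  assumes "positive_definite_on I M"
  shows "trivial_kernel_on I I M"
  unfolding trivial_kernel_on_def
proof (intro allI impI)
  fix w :: "nat \<Rightarrow> real"
  assume "\<forall>i\<in>I. (\<Sum>j\<in>I. M i j * w j) = 0"
  then have "(\<Sum>i\<in>I. w i * (\<Sum>j\<in>I. M i j * w j)) = 0"
    by simp
  then have "(\<Sum>i\<in>I. \<Sum>j\<in>I. w i * M i j * w j) = 0"
    by (simp add: sum_distrib_left mult.assoc)
  then show "\<forall>i\<in>I. w i = 0"
    using assms unfolding positive_definite_on_def by force
qed

lemma sum_toeplitz_eq_sum_hankel:
  "(\<Sum>j\<le>t. toeplitz a (t + i) j * w j) = (\<Sum>j\<le>t. hankel a i j * w (t - j))"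
  by (rule sum.reindex_bij_witness[of _ "\<lambda>j. t - j" "\<lambda>j. t - j"])
    (auto simp: toeplitz_def hankel_def add.commute)

lemma trivial_kernel_on_toeplitz:
  assumes "trivial_kernel_on {..s} {..t} (hankel a)"
  shows "trivial_kernel_on {t..t + s} {..t} (toeplitz a)"
  unfolding trivial_kernel_on_def
proof (intro allI impI)
  fix w :: "nat \<Rightarrow> real"
  assume "\<forall>i\<in>{t..t + s}. (\<Sum>j\<le>t. toeplitz a i j * w j) = 0"
  then have "\<forall>i\<le>s. (\<Sum>j\<le>t. hankel a i j * w (t - j)) = 0"
    by (simp flip: sum_toeplitz_eq_sum_hankel)
  then have "\<forall>j\<le>t. w (t - j) = 0"
    using assms by (auto simp: trivial_kernel_on_def)
  then show "\<forall>j\<in>{..t}. w j = 0"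
    by (metis atMost_iff diff_diff_cancel diff_le_self)
qed

section \<open>The space of a streaming algorithm\<close>

lemma space_mat_le:
  assumes "streaming_algorithm \<beta> u m" "computes_up_to u m M \<tau>" "Max (\<beta> ` {-1..int t}) \<le> b"
  shows "space_mat M t \<tau> \<le> enat b"
  unfolding space_mat_def using assms by (intro Inf_lower) blast

lemma space_mat_ge:
  assumes "\<And>\<beta> u m. streaming_algorithm \<beta> u m \<Longrightarrow> computes_up_to u m M \<tau> \<Longrightarrow>
    b \<le> Max (\<beta> ` {-1..int t})"
  shows "enat b \<le> space_mat M t \<tau>"
  unfolding space_mat_def
proof (rule Inf_greatest, elim CollectE exE conjE)
  fix x c \<beta> u m
  assume "x = enat c" "streaming_algorithm \<beta> u m" "computes_up_to u m M \<tau>"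
    "Max (\<beta> ` {-1..int t}) \<le> c"
  with assms[of \<beta> u m] show "enat b \<le> x"
    by (simp del: Max_le_iff)
qed

lemma mat_apply_eq_sum:
  assumes "finite J" "\<And>j. j \<notin> J \<Longrightarrow> M i j * z j = 0"
  shows "mat_apply M z i = (\<Sum>j\<in>J. M i j * z j)"
  unfolding mat_apply_def using assms by (rule suminf_finite)

subsection \<open>Lower bound\<close>

lemma stream_state_continue:
  assumes "stream_state u z t = stream_state u z' t" "\<And>i. t < i \<Longrightarrow> z i = z' i" "t \<le> i"
  shows "stream_state u z i = stream_state u z' i"
  using assms(3) by (induction i rule: dec_induct) (auto simp: assms(1,2))

lemma small_buffer_collision:
  assumes "streaming_algorithm \<beta> u m" "\<beta> (int t) \<le> t"
  obtains z z' where "z \<in> topspace (Euclidean_space (Suc t))"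
    "z' \<in> topspace (Euclidean_space (Suc t))" "z \<noteq> z'" "stream_state u z t = stream_state u z' t"
proof -
  have "continuous_map (Euclidean_space (Suc t)) (Euclidean_space (\<beta> (int t)))
      (\<lambda>z. stream_state u z t)"
    using assms(1) by (simp add: streaming_algorithm_def)
  with assms(2) have "\<not> inj_on (\<lambda>z. stream_state u z t) (topspace (Euclidean_space (Suc t)))"
    by (intro no_continuous_injection_Euclidean_space) simp_all
  then show thesis
    using that unfolding inj_on_def by blast
qed

lemma mat_apply_Euclidean_space:
  assumes "z \<in> topspace (Euclidean_space (Suc t))"
  shows "mat_apply M z i = (\<Sum>j\<le>t. M i j * z j)"
  using assms by (intro mat_apply_eq_sum) (auto simp: topspace_Euclidean_space)

lemma trivial_kernel_on_imp_buffer_ge: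
  assumes alg: "streaming_algorithm \<beta> u m" and comp: "computes_up_to u m M \<tau>"
    and ker: "trivial_kernel_on {t..\<tau>} {..t} M"
  shows "t + 1 \<le> \<beta> (int t)"
proof (rule ccontr)
  assume "\<not> t + 1 \<le> \<beta> (int t)"
  then have "\<beta> (int t) \<le> t"
    by simp
  with alg obtain z z' where z: "z \<in> topspace (Euclidean_space (Suc t))"
      and z': "z' \<in> topspace (Euclidean_space (Suc t))"
      and "z \<noteq> z'" and collision: "stream_state u z t = stream_state u z' t"
    by (rule small_buffer_collision)
  have "(\<Sum>j\<le>t. M i j * (z j - z' j)) = 0" if "i \<in> {t..\<tau>}" for i
  proof -
    have "stream_state u z i = stream_state u z' i"
      using that z z'
      by (intro stream_state_continue[OF collision]) (auto simp: topspace_Euclidean_space)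
    with comp that have "mat_apply M z i = mat_apply M z' i"
      unfolding computes_up_to_def by (metis atLeastAtMost_iff)
    with z z' show ?thesis
      by (simp add: mat_apply_Euclidean_space right_diff_distrib sum_subtractf)
  qed
  with ker have "\<forall>j\<in>{..t}. z j - z' j = 0"
    unfolding trivial_kernel_on_def by (auto dest: spec[of _ "\<lambda>j. z j - z' j"])
  moreover have "z j = z' j" if "t < j" for j
    using that z z' by (simp add: topspace_Euclidean_space)
  ultimately have "z = z'"
    by (metis atMost_iff eq_iff_diff_eq_0 ext not_le)
  with \<open>z \<noteq> z'\<close> show False ..
qed

lemma trivial_kernel_on_imp_space_mat_ge:
  assumes "trivial_kernel_on {t..\<tau>} {..t} M"
  shows "enat (t + 1) \<le> space_mat M t \<tau>"
proof (rule space_mat_ge)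
  fix \<beta> u m
  assume "streaming_algorithm \<beta> u m" "computes_up_to u m M \<tau>"
  then have "t + 1 \<le> \<beta> (int t)"
    using assms by (rule trivial_kernel_on_imp_buffer_ge)
  also have "\<dots> \<le> Max (\<beta> ` {-1..int t})"
    by (intro Max_ge) auto
  finally show "t + 1 \<le> Max (\<beta> ` {-1..int t})" .
qed

subsection \<open>Upper bound\<close>

definition prefix_buffer :: "int \<Rightarrow> nat" where
  "prefix_buffer k = max 1 (nat (k + 1))"

definition append_input :: "nat \<Rightarrow> (nat \<Rightarrow> real) \<Rightarrow> real \<Rightarrow> nat \<Rightarrow> real" where
  "append_input t s x = s(t := x)"

lemma prefix_buffer_of_nat: "prefix_buffer (int t) = Suc t"
  by (simp add: prefix_buffer_def nat_add_distrib)

lemma stream_state_append_input: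
  "stream_state append_input z t = (\<lambda>i. if i < Suc t then z i else 0)"
  by (induction t) (auto simp: append_input_def fun_eq_iff less_Suc_eq)

lemma streaming_algorithm_append_input: "streaming_algorithm prefix_buffer append_input m"
  unfolding streaming_algorithm_def
proof (intro conjI allI ballI)
  show "prefix_buffer (- 1) = 1"
    by (simp add: prefix_buffer_def)
next
  fix t s x
  assume "s \<in> topspace (Euclidean_space (prefix_buffer (int t - 1)))"
  then show "append_input t s x \<in> topspace (Euclidean_space (prefix_buffer (int t)))"
    by (auto simp: topspace_Euclidean_space prefix_buffer_def append_input_def nat_add_distrib)
next
  fix t
  have "continuous_map (Euclidean_space (Suc t)) euclideanreal (\<lambda>z. z i)" for i
    unfolding Euclidean_space_def
    by (intro continuous_map_from_subtopology continuous_map_product_projection) auto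
  then show "continuous_map (Euclidean_space (Suc t)) (Euclidean_space (prefix_buffer (int t)))
      (\<lambda>z. stream_state append_input z t)"
    by (simp add: prefix_buffer_of_nat stream_state_append_input
        continuous_map_componentwise_Euclidean_space)
qed

lemma computes_up_to_append_input:
  assumes "\<And>i j. i < j \<Longrightarrow> M i j = 0"
  shows "computes_up_to append_input (\<lambda>t s. mat_apply M s t) M \<tau>"
proof -
  have "mat_apply M z t = (\<Sum>j\<le>t. M t j * z j)" for z t
    using assms by (intro mat_apply_eq_sum) auto
  then show ?thesis
    by (simp add: computes_up_to_def stream_state_append_input)
qed

lemma space_mat_lower_triangular_le:
  assumes "\<And>i j. i < j \<Longrightarrow> M i j = 0"
  shows "space_mat M t \<tau> \<le> enat (t + 1)"
proof (rule space_mat_le)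
  show "streaming_algorithm prefix_buffer append_input (\<lambda>t s. mat_apply M s t)"
    by (rule streaming_algorithm_append_input)
  show "computes_up_to append_input (\<lambda>t s. mat_apply M s t) M \<tau>"
    using assms by (rule computes_up_to_append_input)
  show "Max (prefix_buffer ` {-1..int t}) \<le> t + 1"
    by (subst Max_le_iff) (auto simp: prefix_buffer_def)
qed

lemma space_mat_toeplitz_eq:
  assumes "positive_definite_on {..t} (hankel a)"
  shows "space_mat (toeplitz a) t (2 * t) = enat (t + 1)"
proof (rule antisym)
  show "space_mat (toeplitz a) t (2 * t) \<le> enat (t + 1)"
    by (rule space_mat_lower_triangular_le) (simp add: toeplitz_def)
  have "trivial_kernel_on {t..2 * t} {..t} (toeplitz a)"
    using trivial_kernel_on_toeplitz[OF positive_definite_on_imp_trivial_kernel_on[OF assms]]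
    by (simp add: mult_2)
  then show "enat (t + 1) \<le> space_mat (toeplitz a) t (2 * t)"
    by (rule trivial_kernel_on_imp_space_mat_ge)
qed

section \<open>Moment sequences\<close>

lemma has_bochner_integral_square_polynomial:
  fixes M :: "real measure" and w :: "nat \<Rightarrow> real"
  assumes "\<And>k. has_bochner_integral M (\<lambda>x. x ^ k) (a k)"
  shows "has_bochner_integral M (\<lambda>x. (\<Sum>i\<le>n. w i * x ^ i)\<^sup>2)
    (\<Sum>i\<le>n. \<Sum>j\<le>n. w i * hankel a i j * w j)"
proof -
  have "has_bochner_integral M (\<lambda>x. \<Sum>i\<le>n. \<Sum>j\<le>n. w i * w j * x ^ (i + j))
      (\<Sum>i\<le>n. \<Sum>j\<le>n. w i * w j * a (i + j))"
    by (intro has_bochner_integral_sum has_bochner_integral_mult_right assms)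
  then show ?thesis
    by (simp add: power2_eq_square sum_product hankel_def power_add mult_ac)
qed

lemma positive_definite_on_hankel_moments:
  fixes M :: "real measure"
  assumes moments: "\<And>k. has_bochner_integral M (\<lambda>x. x ^ k) (a k)"
    and infinite_support: "\<And>F. finite F \<Longrightarrow> \<not> (AE x in M. x \<in> F)"
  shows "positive_definite_on {..n} (hankel a)"
  unfolding positive_definite_on_def
proof (intro allI impI)
  fix w :: "nat \<Rightarrow> real"
  assume nonzero: "\<exists>i\<in>{..n}. w i \<noteq> 0"
  define p where "p x = (\<Sum>i\<le>n. w i * x ^ i)" for x
  define q where "q = (\<Sum>i\<le>n. \<Sum>j\<le>n. w i * hankel a i j * w j)"
  have q: "has_bochner_integral M (\<lambda>x. (p x)\<^sup>2) q"
    unfolding p_def q_def using moments by (rule has_bochner_integral_square_polynomial)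
  have "finite {x. p x = 0}"
    using nonzero polyfun_finite_roots[of w n] by (auto simp: p_def)
  then have "\<not> (AE x in M. (p x)\<^sup>2 = 0)"
    using infinite_support[of "{x. p x = 0}"] by simp
  then have "q \<noteq> 0"
    using q integral_nonneg_eq_0_iff_AE[of M "\<lambda>x. (p x)\<^sup>2"]
    by (auto simp: has_bochner_integral_iff)
  moreover have "0 \<le> q"
    using q by (auto simp: has_bochner_integral_iff)
  ultimately show "0 < q"
    by simp
qed

section \<open>The arcsine distribution\<close>

text \<open>As \<open>x / 0 = 0\<close>, the density vanishes at the end points, where the true density is infinite.\<close>

definition arcsine_density :: "real \<Rightarrow> real" where
  "arcsine_density x = indicator {0..1} x / (pi * sqrt (x * (1 - x)))"

definition arcsine_measure :: "real measure" where
  "arcsine_measure = density lborel arcsine_density"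

lemma borel_measurable_arcsine_density [measurable]: "arcsine_density \<in> borel_measurable borel"
  unfolding arcsine_density_def by measurable

lemma arcsine_density_nonneg: "0 \<le> arcsine_density x"
  by (simp add: arcsine_density_def indicator_def)

lemma arcsine_measure_infinite_support:
  assumes "finite F"
  shows "\<not> (AE x in arcsine_measure. x \<in> F)"
proof
  assume "AE x in arcsine_measure. x \<in> F"
  then have "AE x in lborel. 0 < arcsine_density x \<longrightarrow> x \<in> F"
    unfolding arcsine_measure_def by (subst (asm) AE_density) auto
  moreover have "AE x in lborel. x \<notin> F"
    using assms by (intro AE_not_in finite_imp_null_set_lborel)
  ultimately have "AE x in lborel. x \<notin> {0<..<1::real}"
    by eventually_elim (auto simp: arcsine_density_def)
  then have "emeasure lborel {0<..<1::real} = 0"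
    by (subst (asm) AE_iff_null_sets[symmetric]) auto
  then show False
    by simp
qed

lemma G_half_eq_Beta: "fps_nth G_half k = Beta (real k + 1/2) (1/2) / pi"
proof -
  have "fps_nth G_half k = pochhammer (1/2) k / fact k"
    by (simp add: G_half_nth_gchoose gbinomial_pochhammer flip: power_mult_distrib)
  also have "pochhammer (1/2) k = Gamma (1/2 + real k) / Gamma (1/2)"
    by (rule pochhammer_Gamma) (auto elim!: nonpos_Ints_cases)
  finally have G_half: "fps_nth G_half k = Gamma (real k + 1/2) / sqrt pi / fact k"
    by (simp add: Gamma_one_half_real add.commute)
  have "real k + 1/2 + 1/2 = 1 + real k"
    by simp
  then have Beta: "Beta (real k + 1/2) (1/2) = Gamma (real k + 1/2) * sqrt pi / fact k"
    unfolding Beta_def by (simp only: Gamma_one_half_real Gamma_fact)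
  show ?thesis
    unfolding G_half Beta by (simp add: divide_simps)
qed

lemma has_integral_arcsine_density:
  "((\<lambda>x. arcsine_density x * x ^ k) has_integral fps_nth G_half k) {0..1}"
proof -
  have "((\<lambda>x. x powr (real k + 1/2 - 1) * (1 - x) powr (1/2 - 1) / pi) has_integral
      fps_nth G_half k) {0..1}"
    unfolding G_half_eq_Beta by (intro has_integral_divide has_integral_Beta_real) auto
  moreover have "x powr (real k + 1/2 - 1) * (1 - x) powr (1/2 - 1) / pi = arcsine_density x * x ^ k"
    if "x \<in> {0..1}" for x :: real
  proof (cases "x = 0 \<or> x = 1")
    case True
    then show ?thesis
      by (auto simp: arcsine_density_def)
  next
    case False
    with that have "0 < x" "x < 1"
      by auto
    have "x powr (real k + 1/2 - 1) = x ^ k / sqrt x"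
      using \<open>0 < x\<close> powr_diff[of x "real k" "1/2"] by (simp add: powr_realpow powr_half_sqrt)
    moreover have "(1 - x) powr (1/2 - 1) = 1 / sqrt (1 - x)"
      using \<open>x < 1\<close> powr_minus_divide[of "1 - x" "1/2"] by (simp add: powr_half_sqrt)
    ultimately show ?thesis
      using that by (simp add: arcsine_density_def real_sqrt_mult)
  qed
  ultimately show ?thesis
    by (rule has_integral_eq[rotated])
qed

lemma has_bochner_integral_arcsine_measure:
  "has_bochner_integral arcsine_measure (\<lambda>x. x ^ k) (fps_nth G_half k)"
proof -
  have nonneg: "0 \<le> arcsine_density x * x ^ k" for x
    by (simp add: arcsine_density_def indicator_def)
  have supported: "indicator {0..1} x * (arcsine_density x * x ^ k) = arcsine_density x * x ^ k" for x
    by (simp add: arcsine_density_def indicator_def)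
  have "(\<integral>\<^sup>+x. ennreal (arcsine_density x * x ^ k) \<partial>lborel) = ennreal (fps_nth G_half k)"
    using nn_integral_has_integral_lebesgue[OF nonneg has_integral_arcsine_density]
    by (simp only: supported)
  then have "has_bochner_integral lborel (\<lambda>x. arcsine_density x * x ^ k) (fps_nth G_half k)"
    using nonneg by (intro has_bochner_integral_nn_integral) (auto simp: G_half_def)
  then show ?thesis
    unfolding arcsine_measure_def
    by (intro has_bochner_integral_density) (auto simp: arcsine_density_nonneg)
qed

theorem theorem1p9:
  fixes t :: nat
  shows "space_gf G_half t (2 * t) = enat (t + 1)"
proof -
  have "positive_definite_on {..t} (hankel (fps_nth G_half))"
    using has_bochner_integral_arcsine_measure arcsine_measure_infinite_support
    by (rule positive_definite_on_hankel_moments)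
  then show ?thesis
    unfolding space_gf_def by (rule space_mat_toeplitz_eq)
qed

end
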